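(* Let $(L,\mu_0,m_0,\alpha)$ be a compatible Hom-Leibniz algebra and let $(L,\mu_t,m_t,\alpha)$ be a trivial infinitesimal deformation of it, with $N:L\to L$ a linear map such that $\mathrm{Id}+tN:(L,\mu_t,m_t,\alpha)\to(L,\mu_0,m_0,\alpha)$ is a homomorphism of compatible Hom-Leibniz algebras for every $t$. Then $N$ is a Nijenhuis operator on the compatible Hom-Leibniz algebra $(L,\mu_0,m_0,\alpha)$.
   Context: $K$ is a field of characteristic $0$. Hom-Leibniz algebra: a triple $(L,[\cdot,\cdot],\alpha)$ with $L$ a $K$-vector space, $[\cdot,\cdot]:L\otimes L\to L$ and $\alpha:L\to L$ linear, such that $[\alpha(x),[y,z]]=[[x,y],\alpha(z)]+[\alpha(y),[x,z]]$ for all $x,y,z\in L$. All Hom-Leibniz algebras are assumed multiplicative: $\alpha([x,y])=[\alpha(x),\alpha(y)]$. Compatible Hom-Leibniz algebra: a quadruple $(L,[\cdot,\cdot],\{\cdot,\cdot\},\alpha)$ such that $(L,[\cdot,\cdot],\alpha)$ and $(L,\{\cdot,\cdot\},\alpha)$ are Hom-Leibniz algebras and for all $x,y,z\in L$ $$[\alpha(x),\{y,z\}]+\{\alpha(x),[y,z]\}=[\{x,y\},\alpha(z)]+\{[x,y],\alpha(z)\}+[\alpha(y),\{x,z\}]+\{\alpha(y),[x,z]\}.$$ A homomorphism $(L_1,[\cdot,\cdot]_1,\{\cdot,\cdot\}_1,\alpha_1)\to(L_2,[\cdot,\cdot]_2,\{\cdot,\cdot\}_2,\alpha_2)$ is a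 linear map $\phi:L_1\to L_2$ with $\phi([x,y]_1)=[\phi(x),\phi(y)]_2$, $\phi(\{x,y\}_1)=\{\phi(x),\phi(y)\}_2$ and $\phi\circ\alpha_1=\alpha_2\circ\phi$. Infinitesimal deformation: let $\mathbb C_\alpha^2(L,L)=\{f\in\mathrm{Hom}(L\otimes L,L)\mid\alpha\circ f=f\circ\alpha^{\otimes2}\}$. For $\mu_1,m_1\in\mathbb C_\alpha^2(L,L)$ put $\mu_t(x,y)=\mu_0(x,y)+t\mu_1(x,y)$ and $m_t(x,y)=m_0(x,y)+tm_1(x,y)$. If $(L,\mu_t,m_t,\alpha)$ is a compatible Hom-Leibniz algebra for every $t$ (in $K$), then $(L,\mu_t,m_t,\alpha)$ is an infinitesimal deformation of $(L,\mu_0,m_0,\alpha)$, generated by $(\mu_1,m_1)$. It is trivial if there is a linear map $N:L\to L$ (independent of $t$) such that $\mathrm{Id}+tN:(L,\mu_t,m_t,\alpha)\to(L,\mu_0,m_0,\alpha)$ is a homomorphism of compatible Hom-Leibniz algebras for every $t$. Nijenhuis operator: a linear map $N:L\to L$ is a Nijenhuis operator on a Hom-Leibniz algebra $(L,[\cdot,\cdot],\alpha)$ if $N\alpha=\alpha N$ and $N([x,N(y)]+[N(x),y]-N[x,y])=[N(x),N(y)]$ for all $x,y\in L$. It is a Nijenhuis operator on a compatible Hom-Leibniz algebra $(L,[\cdot,\cdot],\{\cdot,\cdot\},\alpha)$ if it is a Nijenhuis operator on both $(L,[\cdot,\cdot],\alpha)$ and $(L,\{\cdot,\cdot\},\alpha)$.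 *)

theory Defs
  imports Complex_Main
begin

text \<open>
  A vector space over a field of characteristic 0 is given by the library locale
  \<^locale>\<open>vector_space\<close>: the vectors form a type of class \<^class>\<open>ab_group_add\<close> and
  \<open>scale :: 'k \<Rightarrow> 'a \<Rightarrow> 'a\<close> with \<open>'k :: field_char_0\<close> is the scalar multiplication.
  The unqualified constant \<open>linear\<close> of the library is restricted to real scalars, hence the
  qualified name \<open>Vector_Spaces.linear\<close> below.

  Linear maps on \<open>L \<otimes> L\<close> are rendered as curried bilinear maps.
\<close>

definition bilinear_map ::
    "('k::field_char_0 \<Rightarrow> 'a::ab_group_add \<Rightarrow> 'a) \<Rightarrow> ('a \<Rightarrow> 'a \<Rightarrow> 'a) \<Rightarrow> bool"
  where "bilinear_map scale f \<longleftrightarrow>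
    (\<forall>x. Vector_Spaces.linear scale scale (\<lambda>y. f x y)) \<and>
    (\<forall>y. Vector_Spaces.linear scale scale (\<lambda>x. f x y))"

locale hom_leibniz_algebra = vector_space scale
  for scale :: "'k::field_char_0 \<Rightarrow> 'a::ab_group_add \<Rightarrow> 'a" +
  fixes br :: "'a \<Rightarrow> 'a \<Rightarrow> 'a"
    and \<alpha> :: "'a \<Rightarrow> 'a"
  assumes bilinear_br: "bilinear_map scale br"
    and linear_twist: "Vector_Spaces.linear scale scale \<alpha>"
    and hom_leibniz: "br (\<alpha> x) (br y z) = br (br x y) (\<alpha> z) + br (\<alpha> y) (br x z)"
    and multiplicative: "\<alpha> (br x y) = br (\<alpha> x) (\<alpha> y)"

locale compatible_hom_leibniz_algebra =
  br1: hom_leibniz_algebra scale \<mu> \<alpha> + br2: hom_leibniz_algebra scale m \<alpha>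
  for scale :: "'k::field_char_0 \<Rightarrow> 'a::ab_group_add \<Rightarrow> 'a"
    and \<mu> m :: "'a \<Rightarrow> 'a \<Rightarrow> 'a"
    and \<alpha> :: "'a \<Rightarrow> 'a" +
  assumes compatible:
    "\<mu> (\<alpha> x) (m y z) + m (\<alpha> x) (\<mu> y z) =
     \<mu> (m x y) (\<alpha> z) + m (\<mu> x y) (\<alpha> z) + \<mu> (\<alpha> y) (m x z) + m (\<alpha> y) (\<mu> x z)"

locale compatible_hom_leibniz_hom =
  dom: compatible_hom_leibniz_algebra scale1 \<mu>1 m1 \<alpha>1 +
  cod: compatible_hom_leibniz_algebra scale2 \<mu>2 m2 \<alpha>2
  for scale1 :: "'k::field_char_0 \<Rightarrow> 'a::ab_group_add \<Rightarrow> 'a"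
    and \<mu>1 m1 :: "'a \<Rightarrow> 'a \<Rightarrow> 'a"
    and \<alpha>1 :: "'a \<Rightarrow> 'a"
    and scale2 :: "'k \<Rightarrow> 'b::ab_group_add \<Rightarrow> 'b"
    and \<mu>2 m2 :: "'b \<Rightarrow> 'b \<Rightarrow> 'b"
    and \<alpha>2 :: "'b \<Rightarrow> 'b" +
  fixes \<phi> :: "'a \<Rightarrow> 'b"
  assumes linear_hom: "Vector_Spaces.linear scale1 scale2 \<phi>"
    and hom_first: "\<phi> (\<mu>1 x y) = \<mu>2 (\<phi> x) (\<phi> y)"
    and hom_second: "\<phi> (m1 x y) = m2 (\<phi> x) (\<phi> y)"
    and hom_twist: "\<phi> \<circ> \<alpha>1 = \<alpha>2 \<circ> \<phi>"

definition cochains2 ::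
    "('k::field_char_0 \<Rightarrow> 'a::ab_group_add \<Rightarrow> 'a) \<Rightarrow> ('a \<Rightarrow> 'a) \<Rightarrow> ('a \<Rightarrow> 'a \<Rightarrow> 'a) set"
  where "cochains2 scale \<alpha> =
    {f. bilinear_map scale f \<and> (\<forall>x y. \<alpha> (f x y) = f (\<alpha> x) (\<alpha> y))}"

definition deformed ::
    "('k::field_char_0 \<Rightarrow> 'a::ab_group_add \<Rightarrow> 'a) \<Rightarrow>
      ('a \<Rightarrow> 'a \<Rightarrow> 'a) \<Rightarrow> ('a \<Rightarrow> 'a \<Rightarrow> 'a) \<Rightarrow> 'k \<Rightarrow> 'a \<Rightarrow> 'a \<Rightarrow> 'a"
  where "deformed scale f0 f1 t = (\<lambda>x y. f0 x y + scale t (f1 x y))"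

text \<open>
  The deformation \<open>(L, \<mu>\<^sub>t, m\<^sub>t, \<alpha>)\<close> of \<open>(L, \<mu>0, m0, \<alpha>)\<close> is presented by the pair
  \<open>(\<mu>1, m1)\<close> generating it.
\<close>

definition infinitesimal_deformation ::
    "('k::field_char_0 \<Rightarrow> 'a::ab_group_add \<Rightarrow> 'a) \<Rightarrow>
      ('a \<Rightarrow> 'a \<Rightarrow> 'a) \<Rightarrow> ('a \<Rightarrow> 'a \<Rightarrow> 'a) \<Rightarrow> ('a \<Rightarrow> 'a) \<Rightarrow>
      ('a \<Rightarrow> 'a \<Rightarrow> 'a) \<Rightarrow> ('a \<Rightarrow> 'a \<Rightarrow> 'a) \<Rightarrow> bool"
  where "infinitesimal_deformation scale \<mu>0 m0 \<alpha> \<mu>1 m1 \<longleftrightarrow>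
    \<mu>1 \<in> cochains2 scale \<alpha> \<and> m1 \<in> cochains2 scale \<alpha> \<and>
    (\<forall>t. compatible_hom_leibniz_algebra scale
            (deformed scale \<mu>0 \<mu>1 t) (deformed scale m0 m1 t) \<alpha>)"

definition trivial_infinitesimal_deformation ::
    "('k::field_char_0 \<Rightarrow> 'a::ab_group_add \<Rightarrow> 'a) \<Rightarrow>
      ('a \<Rightarrow> 'a \<Rightarrow> 'a) \<Rightarrow> ('a \<Rightarrow> 'a \<Rightarrow> 'a) \<Rightarrow> ('a \<Rightarrow> 'a) \<Rightarrow>
      ('a \<Rightarrow> 'a \<Rightarrow> 'a) \<Rightarrow> ('a \<Rightarrow> 'a \<Rightarrow> 'a) \<Rightarrow> bool"
  where "trivial_infinitesimal_deformation scale \<mu>0 m0 \<alpha> \<mu>1 m1 \<longleftrightarrow>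
    infinitesimal_deformation scale \<mu>0 m0 \<alpha> \<mu>1 m1 \<and>
    (\<exists>N. Vector_Spaces.linear scale scale N \<and>
      (\<forall>t. compatible_hom_leibniz_hom
              scale (deformed scale \<mu>0 \<mu>1 t) (deformed scale m0 m1 t) \<alpha>
              scale \<mu>0 m0 \<alpha>
              (\<lambda>x. x + scale t (N x))))"

locale nijenhuis_operator = hom_leibniz_algebra scale br \<alpha>
  for scale :: "'k::field_char_0 \<Rightarrow> 'a::ab_group_add \<Rightarrow> 'a"
    and br :: "'a \<Rightarrow> 'a \<Rightarrow> 'a"
    and \<alpha> :: "'a \<Rightarrow> 'a" +
  fixes N :: "'a \<Rightarrow> 'a"
  assumes linear_N: "Vector_Spaces.linear scale scale N"
    and N_twist: "N \<circ> \<alpha> = \<alpha> \<circ> N"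
    and nijenhuis: "N (br x (N y) + br (N x) y - N (br x y)) = br (N x) (N y)"

locale compatible_nijenhuis_operator =
  compatible_hom_leibniz_algebra scale \<mu> m \<alpha> +
  nij1: nijenhuis_operator scale \<mu> \<alpha> N + nij2: nijenhuis_operator scale m \<alpha> N
  for scale :: "'k::field_char_0 \<Rightarrow> 'a::ab_group_add \<Rightarrow> 'a"
    and \<mu> m :: "'a \<Rightarrow> 'a \<Rightarrow> 'a"
    and \<alpha> N :: "'a \<Rightarrow> 'a"

end

theory Submission
  imports Defs
begin

text \<open>
  Comparing coefficients of \<open>t\<close> and \<open>t\<^sup>2\<close> in
  \<open>(Id + tN)(f x y + t g x y) = f (x + t N x) (y + t N y)\<close> gives
  \<open>g x y = f x (N y) + f (N x) y - N (f x y)\<close> and \<open>N (g x y) = f (N x) (N y)\<close>,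
  whose combination is the Nijenhuis identity. In characteristic 0 the values
  \<open>t = 1\<close> and \<open>t = -1\<close> suffice to separate the coefficients.
\<close>

lemma nijenhuis_identity_of_deformation:
  fixes scale :: "'k::field_char_0 \<Rightarrow> 'a::ab_group_add \<Rightarrow> 'a"
  assumes "vector_space scale"
    and f: "bilinear_map scale f"
    and N: "Vector_Spaces.linear scale scale N"
    and hom: "\<And>t x y. deformed scale f g t x y + scale t (N (deformed scale f g t x y)) =
      f (x + scale t (N x)) (y + scale t (N y))"
  shows "N (f x (N y) + f (N x) y - N (f x y)) = f (N x) (N y)"
proof -
  interpret vector_space scale by fact
  interpret N: Vector_Spaces.linear scale scale N by fact
  interpret fl: Vector_Spaces.linear scale scale "\<lambda>u. f u v" for v
    using f by (simp add: bilinear_map_def)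
  interpret fr: Vector_Spaces.linear scale scale "\<lambda>v. f u v" for u
    using f by (simp add: bilinear_map_def)
  \<comment> \<open>\<open>A\<close> and \<open>B\<close> are the coefficients of \<open>t\<close>
    and \<open>t^2\<close> in the left side of \<open>hom\<close> minus its right side; the constant
    terms \<open>f x y\<close> cancel. So \<open>hom\<close> says
    \<open>tA + t^2 B = 0\<close>.\<close>
  define A where "A = g x y + N (f x y) - (f x (N y) + f (N x) y)"
  define B where "B = N (g x y) - f (N x) (N y)"
  have plus: "A + B = 0"
    using hom[of 1 x y] unfolding A_def B_def deformed_def
    by (simp add: fl.add fr.add N.add algebra_simps)
  have minus: "B - A = 0"
    using hom[of "-1" x y] unfolding A_def B_def deformed_def
    by (simp add: fl.diff fr.diff N.diff algebra_simps)
  from plus minus have "B = A" and "A + A = 0" by simp_all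
  \<comment> \<open>\<open>A + A = 0\<close> alone does not exclude 2-torsion; as a scalar multiple
    by 2, nonzero in characteristic 0, it forces \<open>A = 0\<close>.\<close>
  have "scale 2 A = A + A"
    using scale_left_distrib[of 1 1 A] by simp
  with \<open>A + A = 0\<close> have "A = 0" by simp
  with \<open>B = A\<close> have "B = 0" by simp
  from \<open>A = 0\<close> \<open>B = 0\<close> have "g x y = f x (N y) + f (N x) y - N (f x y)" and "N (g x y) = f (N x) (N y)"
    by (simp_all add: A_def B_def algebra_simps)
  then show ?thesis by simp
qed

theorem theorem5p3:
  fixes scale :: "'k::field_char_0 \<Rightarrow> 'a::ab_group_add \<Rightarrow> 'a"
    and \<mu>0 m0 \<mu>1 m1 :: "'a \<Rightarrow> 'a \<Rightarrow> 'a"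
    and \<alpha> N :: "'a \<Rightarrow> 'a"
  assumes "compatible_hom_leibniz_algebra scale \<mu>0 m0 \<alpha>"
    and "trivial_infinitesimal_deformation scale \<mu>0 m0 \<alpha> \<mu>1 m1"
    and "Vector_Spaces.linear scale scale N"
    and "\<And>t. compatible_hom_leibniz_hom
                 scale (deformed scale \<mu>0 \<mu>1 t) (deformed scale m0 m1 t) \<alpha>
                 scale \<mu>0 m0 \<alpha>
                 (\<lambda>x. x + scale t (N x))"
  shows "compatible_nijenhuis_operator scale \<mu>0 m0 \<alpha> N"
proof -
  interpret compatible_hom_leibniz_algebra scale \<mu>0 m0 \<alpha> by fact
  interpret \<alpha>: Vector_Spaces.linear scale scale \<alpha>
    by (rule br1.linear_twist)
  interpret N: Vector_Spaces.linear scale scale N by fact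
  note hom = assms(4)
  \<comment> \<open>The twist is not deformed, so at \<open>t = 1\<close> the map
    \<open>Id + N\<close> commutes with \<open>\<alpha>\<close>; cancel
    \<open>\<alpha> x\<close>.\<close>
  have "N (\<alpha> x) = \<alpha> (N x)" for x
    using fun_cong[OF compatible_hom_leibniz_hom.hom_twist[OF hom[of 1]], of x]
    by (simp add: \<alpha>.add)
  then have twist: "N \<circ> \<alpha> = \<alpha> \<circ> N"
    by (simp add: fun_eq_iff)
  \<comment> \<open>\<open>hom\<close> keeps \<open>t\<close> free, so each bracket supplies the
    whole family of identities: here \<open>g\<close> is \<open>\<mu>1\<close>, below it is
    \<open>m1\<close>.\<close>
  have nij1: "N (\<mu>0 x (N y) + \<mu>0 (N x) y - N (\<mu>0 x y)) = \<mu>0 (N x) (N y)" for x y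
    using br1.vector_space_axioms br1.bilinear_br assms(3)
      compatible_hom_leibniz_hom.hom_first[OF hom]
    by (rule nijenhuis_identity_of_deformation)
  have nij2: "N (m0 x (N y) + m0 (N x) y - N (m0 x y)) = m0 (N x) (N y)" for x y
    using br1.vector_space_axioms br2.bilinear_br assms(3)
      compatible_hom_leibniz_hom.hom_second[OF hom]
    by (rule nijenhuis_identity_of_deformation)
  interpret nij1: nijenhuis_operator scale \<mu>0 \<alpha> N
    using assms(3) twist nij1 by unfold_locales
  interpret nij2: nijenhuis_operator scale m0 \<alpha> N
    using assms(3) twist nij2 by unfold_locales
  show ?thesis
    by unfold_locales
qed

end
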